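(* Let $\eta=(\eta_j)_{j\ge1}$ be a random sequence that is swap-invariant under a probability measure $\mathbf{Q}$. Further let $X$ be a random variable with $X\neq0$ $\mathbf{Q}$-almost surely and $c=\mathbf{E}_{\mathbf{Q}}[|X|^{-1}]<\infty$. Define another probability measure $\mathbf{P}$ by $$\frac{\mathrm{d}\mathbf{P}}{\mathrm{d}\mathbf{Q}}=\frac{1}{c\,|X|}.$$ Then the sequence $\xi_j=X\eta_j$ ($j\ge1$) is swap-invariant under $\mathbf{P}$.
   Context: Random sequences are sequences of real-valued random variables. A sequence $\xi$ of integrable random variables is swap-invariant if for every $n\ge1$, every permutation $\pi$ of $\{1,\dots,n\}$ and every $u\in\mathbb{R}^n$, $\mathbf{E}\,\big|\sum_{j=1}^n u_j\xi_j\big|=\mathbf{E}\,\big|\sum_{j=1}^n u_j\xi_{\pi(j)}\big|$; "under $\mathbf{Q}$" means that integrability and expectations refer to $\mathbf{Q}$. *)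

theory Defs
  imports "HOL-Probability.Probability" "HOL-Combinatorics.Permutations"
begin

(* Sequences are indexed by j >= 1; the value at index 0 is ignored.
   A vector u in R^n is a function nat => real, of which only u 1, ..., u n matter. *)
definition swap_invariant :: "'a measure \<Rightarrow> (nat \<Rightarrow> 'a \<Rightarrow> real) \<Rightarrow> bool" where
  "swap_invariant M \<xi> \<longleftrightarrow>
     (\<forall>j\<ge>1. integrable M (\<xi> j)) \<and>
     (\<forall>n\<ge>1. \<forall>\<pi>. \<pi> permutes {1..n} \<longrightarrow>
        (\<forall>u :: nat \<Rightarrow> real.
           (\<integral>\<omega>. \<bar>\<Sum>j=1..n. u j * \<xi> j \<omega>\<bar> \<partial>M) =
           (\<integral>\<omega>. \<bar>\<Sum>j=1..n. u j * \<xi> (\<pi> j) \<omega>\<bar> \<partial>M)))"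

end

theory Submission
  imports Defs
begin

text \<open>The density of \<open>P\<close> cancels the factor \<open>X\<close>: wherever
  \<open>X\<close> is nonzero, |X f| / (c |X|) = |f| / c. Hence multiplying by \<open>X\<close> and
  passing from \<open>Q\<close> to \<open>P\<close> scales the L1 norm by 1/c. As \<open>X\<close>
  factors out of every linear combination, both sides of the swap identity under \<open>P\<close>
  are those under \<open>Q\<close> divided by \<open>c\<close>, and integrability transfers
  likewise.\<close>

text \<open>This is the cancellation for a single \<open>f\<close>, later taken to be a linear
  combination of the \<eta> j. The case \<open>c = 0\<close> is harmless: division by zero gives 0,
  so the density and both sides of the identity vanish.\<close>

lemma
  fixes X f :: "'a \<Rightarrow> real" and c :: real
  assumes X: "X \<in> borel_measurable Q" "AE \<omega> in Q. X \<omega> \<noteq> 0"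
    and c: "c \<ge> 0"
    and f: "integrable Q f"
  defines "P \<equiv> density Q (\<lambda>\<omega>. ennreal (1 / (c * \<bar>X \<omega>\<bar>)))"
  shows integrable_density_inverse_abs: "integrable P (\<lambda>\<omega>. X \<omega> * f \<omega>)"
    and integral_density_inverse_abs:
      "(\<integral>\<omega>. \<bar>X \<omega> * f \<omega>\<bar> \<partial>P) = (\<integral>\<omega>. \<bar>f \<omega>\<bar> \<partial>Q) / c"
proof -
  note [measurable] = X(1) borel_measurable_integrable[OF f]
  have "integrable Q (\<lambda>\<omega>. \<bar>f \<omega>\<bar> / c)"
    using f by auto
  \<comment> \<open>Off the null set where \<open>X\<close> vanishes, the absolute value of this
    integrand equals the bound |f| / c.\<close>
  then have "integrable Q (\<lambda>\<omega>. (1 / (c * \<bar>X \<omega>\<bar>)) *\<^sub>R (X \<omega> * f \<omega>))"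
    by (rule Bochner_Integration.integrable_bound) (use X(2) c in \<open>auto simp: abs_mult\<close>)
  then show "integrable P (\<lambda>\<omega>. X \<omega> * f \<omega>)"
    unfolding P_def using c by (subst integrable_density) auto
  have "(\<integral>\<omega>. \<bar>X \<omega> * f \<omega>\<bar> \<partial>P) = (\<integral>\<omega>. (1 / (c * \<bar>X \<omega>\<bar>)) *\<^sub>R \<bar>X \<omega> * f \<omega>\<bar> \<partial>Q)"
    unfolding P_def using c by (subst integral_density) auto
  also have "\<dots> = (\<integral>\<omega>. \<bar>f \<omega>\<bar> / c \<partial>Q)"
    using X(2) by (intro integral_cong_AE) (auto simp: abs_mult)
  finally show "(\<integral>\<omega>. \<bar>X \<omega> * f \<omega>\<bar> \<partial>P) = (\<integral>\<omega>. \<bar>f \<omega>\<bar> \<partial>Q) / c"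
    by simp
qed

theorem proposition3p3:
  fixes Q P :: "'a measure"
    and \<eta> :: "nat \<Rightarrow> 'a \<Rightarrow> real"
    and X :: "'a \<Rightarrow> real"
    and c :: real
  assumes "prob_space Q"
    and "swap_invariant Q \<eta>"
    and "X \<in> borel_measurable Q"
    and "AE \<omega> in Q. X \<omega> \<noteq> 0"
    and "integrable Q (\<lambda>\<omega>. inverse \<bar>X \<omega>\<bar>)"
    and "c = (\<integral>\<omega>. inverse \<bar>X \<omega>\<bar> \<partial>Q)"
    and "P = density Q (\<lambda>\<omega>. ennreal (1 / (c * \<bar>X \<omega>\<bar>)))"
  shows "prob_space P \<and> swap_invariant P (\<lambda>j \<omega>. X \<omega> * \<eta> j \<omega>)"
proof
  interpret Q: prob_space Q by fact
  note X [measurable] = assms(3)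
  have c_nonneg: "c \<ge> 0"
    unfolding assms(6) by simp
  \<comment> \<open>A nonnegative function with integral 0 vanishes almost everywhere, but the
    inverse of a nonzero number is nonzero. This is what makes the total mass of \<open>P\<close>
    equal to c / c = 1.\<close>
  have "c \<noteq> 0"
  proof
    assume "c = 0"
    then have "AE \<omega> in Q. inverse \<bar>X \<omega>\<bar> = 0"
      using integral_nonneg_eq_0_iff_AE[OF assms(5)] assms(6) by simp
    with assms(4) have "AE \<omega> in Q. False"
      by eventually_elim simp
    then show False by simp
  qed
  have "(\<integral>\<^sup>+\<omega>. ennreal (1 / (c * \<bar>X \<omega>\<bar>)) \<partial>Q) = (\<integral>\<^sup>+\<omega>. ennreal (inverse \<bar>X \<omega>\<bar> / c) \<partial>Q)"
    by (simp add: field_simps)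
  also have "\<dots> = ennreal (\<integral>\<omega>. inverse \<bar>X \<omega>\<bar> / c \<partial>Q)"
    using assms(5) c_nonneg by (intro nn_integral_eq_integral integrable_divide_zero) auto
  also have "\<dots> = 1"
    using \<open>c \<noteq> 0\<close> assms(6) by simp
  finally show "prob_space P"
    unfolding assms(7) by (intro prob_spaceI) (simp add: emeasure_density cong: nn_integral_cong)
  note integrable_P = integrable_density_inverse_abs[OF assms(3,4) c_nonneg, folded assms(7)]
    and integral_P = integral_density_inverse_abs[OF assms(3,4) c_nonneg, folded assms(7)]
  have integrable: "integrable Q (\<eta> j)" if "j \<ge> 1" for j
    using assms(2) that by (simp add: swap_invariant_def)
  have lincomb: "(\<integral>\<omega>. \<bar>\<Sum>j=1..n. u j * (X \<omega> * \<eta> (\<pi> j) \<omega>)\<bar> \<partial>P)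
      = (\<integral>\<omega>. \<bar>\<Sum>j=1..n. u j * \<eta> (\<pi> j) \<omega>\<bar> \<partial>Q) / c"
    if "\<And>j. j \<in> {1..n} \<Longrightarrow> \<pi> j \<ge> 1" for n \<pi> and u :: "nat \<Rightarrow> real"
  proof -
    have "integrable Q (\<lambda>\<omega>. \<Sum>j=1..n. u j * \<eta> (\<pi> j) \<omega>)"
      using that by (intro Bochner_Integration.integrable_sum integrable_mult_right integrable)
    from integral_P[OF this] show ?thesis
      by (simp add: sum_distrib_left mult.left_commute)
  qed
  show "swap_invariant P (\<lambda>j \<omega>. X \<omega> * \<eta> j \<omega>)"
    unfolding swap_invariant_def
  proof (intro conjI allI impI)
    fix n :: nat and \<pi> u assume n: "n \<ge> 1" and \<pi>: "\<pi> permutes {1..n}"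
    \<comment> \<open>A permutation of {1..n} maps this set to itself, so index 0 is never
      reached.\<close>
    have "\<pi> j \<ge> 1" if "j \<in> {1..n}" for j
      using permutes_in_image[OF \<pi>, of j] that by simp
    moreover have "(\<integral>\<omega>. \<bar>\<Sum>j=1..n. u j * \<eta> j \<omega>\<bar> \<partial>Q) = (\<integral>\<omega>. \<bar>\<Sum>j=1..n. u j * \<eta> (\<pi> j) \<omega>\<bar> \<partial>Q)"
      using assms(2) n \<pi> by (simp add: swap_invariant_def)
    ultimately show "(\<integral>\<omega>. \<bar>\<Sum>j=1..n. u j * (X \<omega> * \<eta> j \<omega>)\<bar> \<partial>P)
        = (\<integral>\<omega>. \<bar>\<Sum>j=1..n. u j * (X \<omega> * \<eta> (\<pi> j) \<omega>)\<bar> \<partial>P)"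
      using lincomb[of n "\<lambda>j. j" u] lincomb[of n \<pi> u] by simp
  qed (simp add: integrable_P integrable)
qed

end
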